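(* Let $a=0$ (ReLU activation) and let $s>0$ be real. Define $$I_0(s,d)=2^{s/2}\sum_{n=1}^{d}\binom{d}{n}\frac{1}{2^{d}}\,\frac{\Gamma(n/2+s/2)}{\Gamma(n/2)}$$ ($\Gamma$ is Euler's Gamma function). Then for every $k\ge 0$, $$\mathbb{E}\big[\|x^{(k)}\|^s\big]=\|x^{(0)}\|^s\big(\sigma^s I_0(s,d)\big)^k .$$ Let $\bar{\sigma}_0(s,d):=I_0(s,d)^{-1/s}$ and assume $x^{(0)}\neq 0$. Then: (i) if $\sigma=\bar{\sigma}_0(s,d)$, then $\mathbb{E}\|x^{(k)}\|^s=\|x^{(0)}\|^s$ for every $k\ge1$, while for every $p>s$, $\mathbb{E}\|x^{(k)}\|^p\to\infty$ exponentially fast in $k$; (ii) if $\sigma<\bar{\sigma}_0(s,d)$, then $\mathbb{E}\|x^{(k)}\|^s\to 0$ exponentially fast in $k$; (iii) if $\sigma>\bar{\sigma}_0(s,d)$, then $\mathbb{E}\|x^{(k)}\|^s\to\infty$ exponentially fast in $k$.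
   Context: Fix an integer width $d\ge1$ and a parameter $a\in[0,1]$. The parametric ReLU $\phi_a:\mathbb{R}\to\mathbb{R}$ is $\phi_a(z)=z$ for $z>0$ and $\phi_a(z)=az$ for $z\le 0$; it is applied componentwise to vectors ($\phi_0$ is ReLU, $\phi_1$ is the identity). Given $\sigma>0$ and a deterministic input $x^{(0)}\in\mathbb{R}^d$, the layer outputs of the fully connected network with zero biases are $x^{(k+1)}=\phi_a(W^{(k+1)}x^{(k)})$, $k\ge0$, where all entries of all matrices $W^{(1)},W^{(2)},\dots\in\mathbb{R}^{d\times d}$ are i.i.d. $\mathcal{N}(0,\sigma^2)$. $\|\cdot\|$ denotes the Euclidean norm. *)

theory Defs
  imports "HOL-Probability.Probability"
begin

definition prelu :: "real \<Rightarrow> real \<Rightarrow> real" where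
  "prelu a z = (if z > 0 then z else a * z)"

text \<open>Layer outputs of the zero-bias fully connected network of width CARD('n).
  W k is the weight matrix applied to produce layer k+1 (i.e. W k = W^(k+1) of the paper).\<close>
fun layer_out :: "real \<Rightarrow> (nat \<Rightarrow> 'w \<Rightarrow> real^'n^'n) \<Rightarrow> real^'n \<Rightarrow> nat \<Rightarrow> 'w \<Rightarrow> real^'n" where
  "layer_out a W x0 0 \<omega> = x0"
| "layer_out a W x0 (Suc k) \<omega> = (\<chi> i. prelu a ((W k \<omega> *v layer_out a W x0 k \<omega>) $ i))"

definition I0 :: "real \<Rightarrow> nat \<Rightarrow> real" where
  "I0 s d = 2 powr (s/2) * (\<Sum>n=1..d. real (d choose n) * (1 / 2^d) *
              (Gamma (real n / 2 + s / 2) / Gamma (real n / 2)))"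

definition sigma_bar0 :: "real \<Rightarrow> nat \<Rightarrow> real" where
  "sigma_bar0 s d = I0 s d powr (-1 / s)"

end

theory Submission
  imports Defs
begin

text \<open>For a fixed input v, the pre-activations W v of a layer are independent N(0, sigma^2 |v|^2)
  variables, so |relu(W v)|^2 / (2 sigma^2 |v|^2) is a sum of d independent copies of
  (max g 0)^2 / 2 with g standard normal. Each copy vanishes with probability 1/2 and is otherwise
  Gamma(1/2)-distributed, hence the sum is a binomial(d, 1/2) mixture of the laws Gamma(n/2), whose
  moments are explicit Gamma ratios: this gives E |relu(W v)|^s = sigma^s I0(s,d) |v|^s. As the
  weights of a layer are independent of the earlier layers, conditioning on them iterates this
  identity, and the trichotomy comes from comparing sigma^s I0(s,d) = (sigma / sigma_bar0)^s with 1.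
  At the critical variance, Young's inequality z^(s/2) <= (s/p) z^(p/2) + 1 - s/p, applied under the
  mixture, whose atom at 0 has mass 2^-d, forces sigma^p I0(p,d) > 1 for every p > s.\<close>

section \<open>Gamma densities\<close>

definition gamma_density :: "real \<Rightarrow> real \<Rightarrow> real" where
  "gamma_density a t = indicator {0..} t * t powr (a - 1) / exp t / Gamma a"

lemma gamma_density_nonneg: "a > 0 \<Longrightarrow> gamma_density a t \<ge> 0"
  unfolding gamma_density_def by (auto simp: indicator_def intro!: divide_nonneg_pos Gamma_real_pos)

lemma borel_measurable_gamma_density[measurable]: "gamma_density a \<in> borel_measurable borel"
  unfolding gamma_density_def by measurable

lemma nn_integral_powr_gamma_density:
  assumes a: "a > 0" and c: "c \<ge> 0"
  shows "(\<integral>\<^sup>+w. ennreal (w powr c * gamma_density a w) \<partial>lborel) = ennreal (Gamma (a + c) / Gamma a)"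
proof -
  have "(\<integral>\<^sup>+w. ennreal (w powr c * gamma_density a w) \<partial>lborel)
      = (\<integral>\<^sup>+w. ennreal (indicator {0..} w * w powr (a + c - 1) / exp w) * ennreal (1 / Gamma a) \<partial>lborel)"
  proof (intro nn_integral_cong)
    fix w :: real
    show "ennreal (w powr c * gamma_density a w)
        = ennreal (indicator {0..} w * w powr (a + c - 1) / exp w) * ennreal (1 / Gamma a)"
    proof (cases "w > 0")
      case True
      then have "w powr c * w powr (a - 1) = w powr (a + c - 1)"
        by (simp add: powr_add[symmetric] add_diff_eq add.commute)
      then show ?thesis using True a
        by (subst ennreal_mult'[symmetric])
           (auto simp: gamma_density_def indicator_def Gamma_real_pos less_imp_le field_simps)
    next
      case False
      then show ?thesis by (cases "w = 0") (auto simp: gamma_density_def indicator_def)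
    qed
  qed
  also have "\<dots> = (\<integral>\<^sup>+w. ennreal (indicator {0..} w * w powr (a + c - 1) / exp w) \<partial>lborel) * ennreal (1 / Gamma a)"
    by (rule nn_integral_multc) measurable
  also have "\<dots> = ennreal (Gamma (a + c)) * ennreal (1 / Gamma a)"
    using a c by (subst Gamma_conv_nn_integral_real) auto
  also have "\<dots> = ennreal (Gamma (a + c) / Gamma a)"
    using a c by (subst ennreal_mult'[symmetric]) (auto intro: Gamma_real_pos less_imp_le)
  finally show ?thesis .
qed

lemma nn_integral_gamma_density:
  assumes a: "a > 0"
  shows "(\<integral>\<^sup>+w. ennreal (gamma_density a w) \<partial>lborel) = 1"
proof -
  have "(\<integral>\<^sup>+w. ennreal (gamma_density a w) \<partial>lborel) = (\<integral>\<^sup>+w. ennreal (w powr 0 * gamma_density a w) \<partial>lborel)"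
    by (intro nn_integral_cong) (auto simp: gamma_density_def indicator_def)
  also have "\<dots> = 1"
    using nn_integral_powr_gamma_density[OF a, of 0] Gamma_real_pos[OF a] by simp
  finally show ?thesis .
qed

lemma nn_integral_scaled_powr_gamma_density:
  assumes a: "a > 0" and c: "c > 0" and q: "q > 0"
  shows "(\<integral>\<^sup>+w. ennreal ((c * w) powr q) * ennreal (gamma_density a w) \<partial>lborel)
       = ennreal (c powr q * (Gamma (a + q) / Gamma a))"
proof -
  have "(\<integral>\<^sup>+w. ennreal ((c * w) powr q) * ennreal (gamma_density a w) \<partial>lborel)
      = (\<integral>\<^sup>+w. ennreal (w powr q * gamma_density a w) * ennreal (c powr q) \<partial>lborel)"
  proof (intro nn_integral_cong)
    fix w :: real
    show "ennreal ((c * w) powr q) * ennreal (gamma_density a w)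
        = ennreal (w powr q * gamma_density a w) * ennreal (c powr q)"
    proof (cases "w \<ge> 0")
      case True
      then show ?thesis
        using c gamma_density_nonneg[OF a, of w] by (simp add: powr_mult ennreal_mult[symmetric] mult_ac)
    qed (simp add: gamma_density_def)
  qed
  also have "\<dots> = ennreal (Gamma (a + q) / Gamma a) * ennreal (c powr q)"
    by (subst nn_integral_multc) (auto simp: nn_integral_powr_gamma_density[OF a] q less_imp_le)
  also have "\<dots> = ennreal (c powr q * (Gamma (a + q) / Gamma a))"
    using a q by (subst ennreal_mult[symmetric])
                 (auto simp: mult.commute intro!: divide_nonneg_pos Gamma_real_pos less_imp_le)
  finally show ?thesis .
qed

lemma nn_integral_Beta_kernel:
  assumes a: "a > 0" and b: "b > 0" and u: "u > 0"
  shows "(\<integral>\<^sup>+t. ennreal (indicator {0..u} t * t powr (a - 1) * (u - t) powr (b - 1)) \<partial>lborel)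
       = ennreal (u powr (a + b - 1) * Beta a b)"
proof -
  have "(\<integral>\<^sup>+t. ennreal (indicator {0..u} t * t powr (a - 1) * (u - t) powr (b - 1)) \<partial>lborel)
      = (\<integral>\<^sup>+t. ennreal (indicator {0..1} t * (u * t) powr (a - 1) * (u - u * t) powr (b - 1))
           \<partial>distr lborel borel ((*) (1 / u)))" (is "_ = nn_integral _ ?f")
    using u by (subst nn_integral_distr) (auto simp: indicator_def field_simps intro!: nn_integral_cong)
  also have "distr lborel borel ((*) (1 / u)) = density lborel (\<lambda>_. u)"
    using u by (subst lborel_distr_mult) auto
  also have "nn_integral \<dots> ?f = (\<integral>\<^sup>+x. ennreal (indicator {0..1} x * (u * (u * x) powr (a - 1) *
               (u * (1 - x)) powr (b - 1))) \<partial>lborel)"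
    using u by (subst nn_integral_density) (auto simp: ennreal_mult'[symmetric] algebra_simps)
  also have "\<dots> = (\<integral>\<^sup>+x. ennreal (u powr (a + b - 1)) *
               ennreal (indicator {0..1} x * x powr (a - 1) * (1 - x) powr (b - 1)) \<partial>lborel)"
    using u a b
    by (intro nn_integral_cong)
       (auto simp: indicator_def powr_mult powr_add powr_diff mult_ac ennreal_mult'[symmetric])
  also have "\<dots> = ennreal (u powr (a + b - 1)) *
               (\<integral>\<^sup>+x. ennreal (indicator {0..1} x * x powr (a - 1) * (1 - x) powr (b - 1)) \<partial>lborel)"
    by (subst nn_integral_cmult) auto
  also have "(\<integral>\<^sup>+x. ennreal (indicator {0..1} x * x powr (a - 1) * (1 - x) powr (b - 1)) \<partial>lborel)
      = ennreal (Beta a b)"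
    using nn_integral_has_integral_lebesgue[OF _ has_integral_Beta_real[OF a b]] by (simp add: mult_ac)
  moreover have "Beta a b \<ge> 0"
    using a b by (simp add: Beta_def Gamma_real_pos less_imp_le)
  ultimately show ?thesis
    using u by (simp add: ennreal_mult[symmetric] mult_ac)
qed

lemma gamma_density_convolution:
  assumes a: "a > 0" and b: "b > 0"
  shows "(\<integral>\<^sup>+t. ennreal (gamma_density b (w - t) * gamma_density a t) \<partial>lborel)
       = ennreal (gamma_density (a + b) w)"
proof (cases "w > 0")
  case True
  have "(\<integral>\<^sup>+t. ennreal (gamma_density b (w - t) * gamma_density a t) \<partial>lborel)
      = (\<integral>\<^sup>+t. ennreal (indicator {0..w} t * t powr (a - 1) * (w - t) powr (b - 1)) *
               ennreal (1 / exp w / (Gamma a * Gamma b)) \<partial>lborel)"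
  proof (intro nn_integral_cong)
    fix t :: real
    have "exp (w - t) * exp t = exp w" by (simp add: exp_add[symmetric])
    then show "ennreal (gamma_density b (w - t) * gamma_density a t)
        = ennreal (indicator {0..w} t * t powr (a - 1) * (w - t) powr (b - 1)) *
          ennreal (1 / exp w / (Gamma a * Gamma b))"
      using a b Gamma_real_pos[OF a] Gamma_real_pos[OF b]
      by (subst ennreal_mult'[symmetric]) (auto simp: gamma_density_def indicator_def field_simps)
  qed
  also have "\<dots> = ennreal (w powr (a + b - 1) * Beta a b) * ennreal (1 / exp w / (Gamma a * Gamma b))"
    by (subst nn_integral_multc) (auto simp: nn_integral_Beta_kernel[OF a b True])
  also have "\<dots> = ennreal (gamma_density (a + b) w)"
    using a b True Gamma_real_pos[OF a] Gamma_real_pos[OF b] Gamma_real_pos[of "a + b"]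
      less_imp_neq[OF Gamma_real_pos[OF a]] less_imp_neq[OF Gamma_real_pos[OF b]]
    by (subst ennreal_mult'[symmetric]) (auto simp: gamma_density_def Beta_def field_simps)
  finally show ?thesis .
next
  case False
  then have "ennreal (gamma_density b (w - t) * gamma_density a t) = 0" for t
    by (cases "t = 0") (auto simp: gamma_density_def indicator_def)
  then have "(\<integral>\<^sup>+t. ennreal (gamma_density b (w - t) * gamma_density a t) \<partial>lborel) = 0"
    by simp
  then show ?thesis
    using False by (cases "w = 0") (auto simp: gamma_density_def indicator_def)
qed

lemma nn_integral_gamma_density_add:
  assumes a: "a > 0" and b: "b > 0" and F[measurable]: "F \<in> borel_measurable borel"
  shows "(\<integral>\<^sup>+t. (\<integral>\<^sup>+u. F (t + u) * ennreal (gamma_density b u) \<partial>lborel) * ennreal (gamma_density a t) \<partial>lborel)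
       = (\<integral>\<^sup>+w. F w * ennreal (gamma_density (a + b) w) \<partial>lborel)"
proof -
  have "(\<integral>\<^sup>+t. (\<integral>\<^sup>+u. F (t + u) * ennreal (gamma_density b u) \<partial>lborel) * ennreal (gamma_density a t) \<partial>lborel)
      = (\<integral>\<^sup>+t. (\<integral>\<^sup>+w. F w * ennreal (gamma_density b (w - t) * gamma_density a t) \<partial>lborel) \<partial>lborel)"
  proof (intro nn_integral_cong)
    fix t :: real
    have "(\<integral>\<^sup>+w. F w * ennreal (gamma_density b (w - t) * gamma_density a t) \<partial>lborel)
        = (\<integral>\<^sup>+u. F (t + u) * ennreal (gamma_density b u * gamma_density a t) \<partial>lborel)"
      by (subst lborel_distr_plus[symmetric, of t], subst nn_integral_distr) auto
    also have "\<dots> = (\<integral>\<^sup>+u. F (t + u) * ennreal (gamma_density b u) \<partial>lborel) * ennreal (gamma_density a t)"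
      using a b by (subst nn_integral_multc[symmetric])
                   (auto intro!: nn_integral_cong simp: ennreal_mult gamma_density_nonneg mult.assoc)
    finally show "(\<integral>\<^sup>+u. F (t + u) * ennreal (gamma_density b u) \<partial>lborel) * ennreal (gamma_density a t)
        = (\<integral>\<^sup>+w. F w * ennreal (gamma_density b (w - t) * gamma_density a t) \<partial>lborel)" by simp
  qed
  also have "\<dots> = (\<integral>\<^sup>+w. (\<integral>\<^sup>+t. F w * ennreal (gamma_density b (w - t) * gamma_density a t) \<partial>lborel) \<partial>lborel)"
    by (subst lborel_pair.Fubini') (auto simp: case_prod_unfold)
  also have "\<dots> = (\<integral>\<^sup>+w. F w * ennreal (gamma_density (a + b) w) \<partial>lborel)"
    by (simp add: nn_integral_cmult gamma_density_convolution[OF a b])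
  finally show ?thesis .
qed

lemma powr_le_Young_interpolation:
  fixes z s p :: real
  assumes "0 < s" "s < p" "z \<ge> 0"
  shows "z powr (s/2) \<le> (s/p) * z powr (p/2) + (1 - s/p)"
proof (cases "z = 0")
  case True
  then show ?thesis using assms by simp
next
  case False
  have "(z powr (p/2)) powr (s/p) * 1 powr (1 - s/p) \<le> (s/p) * z powr (p/2) + (1 - s/p) * 1"
    by (rule Youngs_inequality_0) (use assms False in auto)
  moreover have "(z powr (p/2)) powr (s/p) = z powr (s/2)"
    using assms by (simp add: powr_powr)
  ultimately show ?thesis by simp
qed

lemma gamma_moment_le_Young_interpolation:
  fixes s p c :: real
  assumes a: "a > 0" and s: "0 < s" "s < p" and c: "c > 0"
  shows "c powr (s/2) * (Gamma (a + s/2) / Gamma a)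
       \<le> (s/p) * (c powr (p/2) * (Gamma (a + p/2) / Gamma a)) + (1 - s/p)"
proof -
  have p: "p > 0" using s by linarith
  have "ennreal (c powr (s/2) * (Gamma (a + s/2) / Gamma a))
      = (\<integral>\<^sup>+w. ennreal ((c * w) powr (s/2)) * ennreal (gamma_density a w) \<partial>lborel)"
    using nn_integral_scaled_powr_gamma_density[OF a c, of "s/2"] s by simp
  also have "\<dots> \<le> (\<integral>\<^sup>+w. ennreal (s/p) * (ennreal ((c * w) powr (p/2)) * ennreal (gamma_density a w))
                        + ennreal (1 - s/p) * ennreal (gamma_density a w) \<partial>lborel)"
  proof (intro nn_integral_mono)
    fix w :: real
    have "(c * w) powr (s/2) * gamma_density a w
        \<le> ((s/p) * (c * w) powr (p/2) + (1 - s/p)) * gamma_density a w"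
    proof (cases "w \<ge> 0")
      case True
      then show ?thesis
        using s c gamma_density_nonneg[OF a, of w] by (intro mult_right_mono powr_le_Young_interpolation) auto
    qed (simp add: gamma_density_def)
    then show "ennreal ((c * w) powr (s/2)) * ennreal (gamma_density a w)
        \<le> ennreal (s/p) * (ennreal ((c * w) powr (p/2)) * ennreal (gamma_density a w))
          + ennreal (1 - s/p) * ennreal (gamma_density a w)"
      using s p gamma_density_nonneg[OF a, of w]
      by (simp add: ennreal_mult[symmetric] ennreal_plus[symmetric] distrib_right mult.assoc
               del: ennreal_plus)
  qed
  also have "\<dots> = ennreal ((s/p) * (c powr (p/2) * (Gamma (a + p/2) / Gamma a)) + (1 - s/p))"
    using p s a
    by (subst nn_integral_add)
       (auto simp: nn_integral_cmult nn_integral_scaled_powr_gamma_density[OF a c]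
          nn_integral_gamma_density[OF a] ennreal_plus[symmetric] ennreal_mult[symmetric]
          Gamma_real_pos less_imp_le simp del: ennreal_plus)
  finally show ?thesis
    using s p a
    by (subst (asm) ennreal_le_iff)
       (auto intro!: add_nonneg_nonneg mult_nonneg_nonneg divide_nonneg_pos Gamma_real_pos less_imp_le)
qed

section \<open>The squared positive part of a Gaussian\<close>

lemma SUP_indicator_atLeastAtMost:
  fixes b :: "nat \<Rightarrow> real" and f :: "real \<Rightarrow> ennreal"
  assumes "incseq b" and "filterlim b at_top sequentially"
  shows "incseq (\<lambda>i x. f x * indicator {c..b i} x)"
    and "(SUP i. f x * indicator {c..b i} x) = f x * indicator {c..} x"
proof -
  show inc: "incseq (\<lambda>i x. f x * indicator {c..b i} x)"
    using assms(1) by (auto simp: incseq_def le_fun_def split: split_indicator) (meson order_trans)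
  have "\<forall>\<^sub>F i in sequentially. x \<le> b i"
    using assms(2) by (simp add: filterlim_at_top)
  then have "\<forall>\<^sub>F i in sequentially. f x * indicator {c..b i} x = f x * indicator {c..} x"
    by eventually_elim (auto split: split_indicator)
  then have "(\<lambda>i. f x * indicator {c..b i} x) \<longlonglongrightarrow> f x * indicator {c..} x"
    by (rule tendsto_eventually)
  moreover have "incseq (\<lambda>i. f x * indicator {c..b i} x)"
    using inc by (auto simp: incseq_def le_fun_def)
  ultimately show "(SUP i. f x * indicator {c..b i} x) = f x * indicator {c..} x"
    by (intro LIMSEQ_unique[OF LIMSEQ_SUP])
qed

lemma nn_integral_substitution_atLeast:
  fixes f :: "real \<Rightarrow> ennreal" and g g' :: "real \<Rightarrow> real"
  assumes f[measurable]: "f \<in> borel_measurable borel"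
    and deriv: "\<And>x. (g has_real_derivative g' x) (at x)"
    and cont: "continuous_on UNIV g'"
    and nonneg: "\<And>x. a \<le> x \<Longrightarrow> 0 \<le> g' x"
    and lim: "filterlim g at_top at_top"
  shows "(\<integral>\<^sup>+x. f x * indicator {g a..} x \<partial>lborel)
       = (\<integral>\<^sup>+x. f (g x) * ennreal (g' x) * indicator {a..} x \<partial>lborel)"
proof -
  define b where "b i = a + 1 + real i" for i
  have b_lim: "filterlim b at_top sequentially"
    unfolding b_def
    by (intro filterlim_tendsto_add_at_top[OF tendsto_const] filterlim_real_sequentially)
  have b_inc: "incseq b" by (auto simp: b_def incseq_def)
  have g_mono: "g x \<le> g y" if "a \<le> x" "x \<le> y" for x y
    using that deriv nonneg by (intro DERIV_nonneg_imp_nondecreasing[of x y g]) (auto intro: order_trans)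
  have gb_lim: "filterlim (\<lambda>i. g (b i)) at_top sequentially"
    by (rule filterlim_compose[OF lim b_lim])
  have gb_inc: "incseq (\<lambda>i. g (b i))"
    using b_inc by (auto simp: incseq_def b_def intro!: g_mono)
  have [measurable]: "g \<in> borel_measurable borel" "g' \<in> borel_measurable borel"
    using deriv cont
    by (auto intro!: borel_measurable_continuous_onI has_real_derivative_imp_continuous_on)
  have "(\<integral>\<^sup>+x. f x * indicator {g a..} x \<partial>lborel)
      = (\<integral>\<^sup>+x. (SUP i. f x * indicator {g a..g (b i)} x) \<partial>lborel)"
    by (simp add: SUP_indicator_atLeastAtMost[OF gb_inc gb_lim])
  also have "\<dots> = (SUP i. \<integral>\<^sup>+x. f x * indicator {g a..g (b i)} x \<partial>lborel)"
    by (rule nn_integral_monotone_convergence_SUP[OF SUP_indicator_atLeastAtMost(1)[OF gb_inc gb_lim]])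
       measurable
  also have "\<dots> = (SUP i. \<integral>\<^sup>+x. (\<lambda>x. f (g x) * ennreal (g' x)) x * indicator {a..b i} x \<partial>lborel)"
    using deriv nonneg continuous_on_subset[OF cont]
    by (subst nn_integral_substitution_aux[where g' = g']) (auto simp: b_def)
  also have "\<dots> = (\<integral>\<^sup>+x. (SUP i. f (g x) * ennreal (g' x) * indicator {a..b i} x) \<partial>lborel)"
    by (rule nn_integral_monotone_convergence_SUP[OF SUP_indicator_atLeastAtMost(1)[OF b_inc b_lim],
          symmetric]) measurable
  also have "\<dots> = (\<integral>\<^sup>+x. f (g x) * ennreal (g' x) * indicator {a..} x \<partial>lborel)"
    using SUP_indicator_atLeastAtMost(2)[OF b_inc b_lim, where f = "\<lambda>x. f (g x) * ennreal (g' x)"]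
    by simp
  finally show ?thesis .
qed

lemma gamma_density_half_square:
  assumes x: "x > 0"
  shows "gamma_density (1/2) (x\<^sup>2 / 2) * x / 2 = std_normal_density x"
proof -
  have "(x\<^sup>2 / 2) powr (1/2 - 1) = 1 / sqrt (x\<^sup>2 / 2)"
    by (simp add: powr_minus_divide powr_half_sqrt)
  also have "\<dots> = sqrt 2 / x"
    using x by (simp add: real_sqrt_divide)
  finally have g: "gamma_density (1/2) (x\<^sup>2 / 2) = sqrt 2 / x / exp (x\<^sup>2 / 2) / sqrt pi"
    using x by (simp add: gamma_density_def Gamma_one_half_real)
  have "sqrt (2 * pi) = sqrt 2 * sqrt pi"
    by (simp add: real_sqrt_mult)
  then show ?thesis
    using x unfolding g std_normal_density_def by (simp add: exp_minus field_simps)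
qed

lemma nn_integral_std_normal_pos_half_square:
  assumes F[measurable]: "F \<in> borel_measurable borel"
  shows "(\<integral>\<^sup>+x. F (x\<^sup>2 / 2) * ennreal (std_normal_density x * indicator {0<..} x) \<partial>lborel)
       = (\<integral>\<^sup>+w. F w * ennreal (gamma_density (1/2) w / 2) \<partial>lborel)"
proof -
  let ?f = "\<lambda>w. F w * ennreal (gamma_density (1/2) w / 2)"
  have "(\<integral>\<^sup>+w. ?f w \<partial>lborel) = (\<integral>\<^sup>+w. ?f w * indicator {(\<lambda>x. x\<^sup>2 / 2) 0..} w \<partial>lborel)"
    by (intro nn_integral_cong) (auto simp: gamma_density_def indicator_def)
  also have "\<dots> = (\<integral>\<^sup>+x. ?f (x\<^sup>2 / 2) * ennreal x * indicator {0..} x \<partial>lborel)"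
  proof (rule nn_integral_substitution_atLeast)
    have "filterlim (\<lambda>x::real. (x * x) * (1/2)) at_top at_top"
      by (intro filterlim_at_top_mult_tendsto_pos[OF tendsto_const] filterlim_at_top_mult_at_top
            filterlim_ident) auto
    then show "filterlim (\<lambda>x::real. x\<^sup>2 / 2) at_top at_top"
      by (simp add: power2_eq_square)
  qed (auto intro!: derivative_eq_intros continuous_intros)
  also have "\<dots> = (\<integral>\<^sup>+x. F (x\<^sup>2 / 2) * ennreal (std_normal_density x * indicator {0<..} x) \<partial>lborel)"
  proof (intro nn_integral_cong)
    fix x :: real
    show "?f (x\<^sup>2 / 2) * ennreal x * indicator {0..} x
        = F (x\<^sup>2 / 2) * ennreal (std_normal_density x * indicator {0<..} x)"
    proof (cases "x > 0")
      case True
      then show ?thesis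
        using gamma_density_half_square[OF True] gamma_density_nonneg[of "1/2" "x\<^sup>2 / 2"]
        by (simp add: ennreal_mult[symmetric] mult.assoc)
    qed (auto simp: indicator_def)
  qed
  finally show ?thesis ..
qed

lemma nn_integral_std_normal_nonpos:
  "(\<integral>\<^sup>+x. ennreal (std_normal_density x * indicator {..0} x) \<partial>lborel) = ennreal (1/2)"
proof -
  have pos: "(\<integral>\<^sup>+x. ennreal (std_normal_density x * indicator {0<..} x) \<partial>lborel) = ennreal (1/2)"
  proof -
    have "(\<integral>\<^sup>+x. ennreal (std_normal_density x * indicator {0<..} x) \<partial>lborel)
        = (\<integral>\<^sup>+w. ennreal (gamma_density (1/2) w / 2) \<partial>lborel)"
      using nn_integral_std_normal_pos_half_square[of "\<lambda>_. 1"] by simp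
    also have "\<dots> = (\<integral>\<^sup>+w. ennreal (gamma_density (1/2) w) * ennreal (1/2) \<partial>lborel)"
      by (rule nn_integral_cong, subst ennreal_mult'[symmetric]) (auto simp: gamma_density_nonneg)
    also have "\<dots> = ennreal (1/2)"
      by (subst nn_integral_multc) (auto simp: nn_integral_gamma_density)
    finally show ?thesis .
  qed
  have "1 = (\<integral>\<^sup>+x. ennreal (std_normal_density x) \<partial>lborel)"
    by (subst nn_integral_eq_integral) (auto simp: normal_density_nonneg)
  also have "\<dots> = (\<integral>\<^sup>+x. ennreal (std_normal_density x * indicator {..0} x)
                      + ennreal (std_normal_density x * indicator {0<..} x) \<partial>lborel)"
    by (intro nn_integral_cong) (auto simp: indicator_def)
  also have "\<dots> = (\<integral>\<^sup>+x. ennreal (std_normal_density x * indicator {..0} x) \<partial>lborel) + ennreal (1/2)"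
    by (subst nn_integral_add) (auto simp: pos)
  finally have "1 = (\<integral>\<^sup>+x. ennreal (std_normal_density x * indicator {..0} x) \<partial>lborel) + ennreal (1/2)" .
  moreover have "ennreal (1/2) + ennreal (1/2) = 1"
    by (subst ennreal_plus[symmetric]) auto
  ultimately have "ennreal (1/2) + (\<integral>\<^sup>+x. ennreal (std_normal_density x * indicator {..0} x) \<partial>lborel)
      = ennreal (1/2) + ennreal (1/2)"
    by (simp only: add.commute)
  then show ?thesis
    by (simp only: ennreal_add_left_cancel) simp
qed

definition half_sq_relu :: "real \<Rightarrow> real" where
  "half_sq_relu x = (max x 0)\<^sup>2 / 2"

lemma borel_measurable_half_sq_relu[measurable]: "half_sq_relu \<in> borel_measurable borel"
  unfolding half_sq_relu_def by measurable

lemma nn_integral_half_sq_relu_std_normal: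
  assumes F[measurable]: "F \<in> borel_measurable borel"
  shows "2 * (\<integral>\<^sup>+x. F (half_sq_relu x) * ennreal (std_normal_density x) \<partial>lborel)
       = F 0 + (\<integral>\<^sup>+w. F w * ennreal (gamma_density (1/2) w) \<partial>lborel)"
proof -
  have half: "ennreal (t / 2) = ennreal t * ennreal (1/2)" if "t \<ge> 0" for t
    using that by (subst ennreal_mult[symmetric]) auto
  have "(\<integral>\<^sup>+x. F (half_sq_relu x) * ennreal (std_normal_density x) \<partial>lborel)
      = (\<integral>\<^sup>+x. F 0 * ennreal (std_normal_density x * indicator {..0} x) +
               F (x\<^sup>2 / 2) * ennreal (std_normal_density x * indicator {0<..} x) \<partial>lborel)"
    by (intro nn_integral_cong) (auto simp: half_sq_relu_def indicator_def max_def)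
  also have "\<dots> = F 0 * ennreal (1/2) + (\<integral>\<^sup>+w. F w * ennreal (gamma_density (1/2) w / 2) \<partial>lborel)"
    by (subst nn_integral_add)
       (auto simp: nn_integral_cmult nn_integral_std_normal_nonpos nn_integral_std_normal_pos_half_square)
  also have "(\<integral>\<^sup>+w. F w * ennreal (gamma_density (1/2) w / 2) \<partial>lborel)
      = (\<integral>\<^sup>+w. F w * ennreal (gamma_density (1/2) w) \<partial>lborel) * ennreal (1/2)"
    by (subst nn_integral_multc[symmetric])
       (auto intro!: nn_integral_cong simp: half gamma_density_nonneg mult.assoc)
  finally have "2 * (\<integral>\<^sup>+x. F (half_sq_relu x) * ennreal (std_normal_density x) \<partial>lborel)
      = F 0 * (2 * ennreal (1/2)) + (\<integral>\<^sup>+w. F w * ennreal (gamma_density (1/2) w) \<partial>lborel) * (2 * ennreal (1/2))"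
    by (simp only: distrib_left mult.assoc mult.commute mult.left_commute)
  moreover have "2 * ennreal (1/2) = 1"
    by (subst ennreal_numeral[symmetric], subst ennreal_mult[symmetric]) auto
  ultimately show ?thesis by simp
qed

section \<open>Sums of independent squared positive parts\<close>

definition std_normal :: "real measure" where
  "std_normal = density lborel (\<lambda>x. ennreal (std_normal_density x))"

lemma sets_std_normal[measurable_cong, simp]: "sets std_normal = sets borel"
  by (simp add: std_normal_def)

lemma space_std_normal[simp]: "space std_normal = UNIV"
  by (simp add: std_normal_def)

lemma prob_space_std_normal: "prob_space std_normal"
  unfolding std_normal_def by (rule prob_space_normal_density) simp

text \<open>The expectation of F under the Gamma law of shape n/2, i.e. under half a chi-square
  variable with n degrees of freedom; for n = 0 this is the point mass at 0.\<close>
definition gamma_expectation :: "nat \<Rightarrow> (real \<Rightarrow> ennreal) \<Rightarrow> ennreal" where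
  "gamma_expectation n F =
     (if n = 0 then F 0 else \<integral>\<^sup>+w. F w * ennreal (gamma_density (real n / 2) w) \<partial>lborel)"

lemma gamma_expectation_add_half_sq_relu:
  assumes F[measurable]: "F \<in> borel_measurable borel"
  shows "gamma_expectation n (\<lambda>c. 2 * (\<integral>\<^sup>+x. F (c + half_sq_relu x) \<partial>std_normal))
       = gamma_expectation n F + gamma_expectation (Suc n) F"
proof -
  have step: "2 * (\<integral>\<^sup>+x. F (c + half_sq_relu x) \<partial>std_normal)
      = F c + (\<integral>\<^sup>+w. F (c + w) * ennreal (gamma_density (1/2) w) \<partial>lborel)" for c
    using nn_integral_half_sq_relu_std_normal[of "\<lambda>z. F (c + z)"]
    by (simp add: std_normal_def nn_integral_density mult.commute)
  show ?thesis
  proof (cases "n = 0")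
    case False
    then have n: "real n / 2 > 0" by simp
    have "gamma_expectation n (\<lambda>c. 2 * (\<integral>\<^sup>+x. F (c + half_sq_relu x) \<partial>std_normal))
        = gamma_expectation n F + (\<integral>\<^sup>+c. (\<integral>\<^sup>+w. F (c + w) * ennreal (gamma_density (1/2) w) \<partial>lborel)
              * ennreal (gamma_density (real n / 2) c) \<partial>lborel)"
      using False by (simp add: gamma_expectation_def step distrib_right nn_integral_add)
    also have "(\<integral>\<^sup>+c. (\<integral>\<^sup>+w. F (c + w) * ennreal (gamma_density (1/2) w) \<partial>lborel)
              * ennreal (gamma_density (real n / 2) c) \<partial>lborel)
        = (\<integral>\<^sup>+w. F w * ennreal (gamma_density (real n / 2 + 1/2) w) \<partial>lborel)"
      by (rule nn_integral_gamma_density_add[OF n]) auto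
    also have "real n / 2 + 1/2 = real (Suc n) / 2" by simp
    finally show ?thesis by (simp add: gamma_expectation_def)
  qed (simp add: gamma_expectation_def step)
qed

lemma sum_choose_Pascal:
  fixes a :: "nat \<Rightarrow> 'a::comm_semiring_1"
  shows "(\<Sum>n\<le>m. of_nat (m choose n) * (a n + a (Suc n))) = (\<Sum>n\<le>Suc m. of_nat (Suc m choose n) * a n)"
proof -
  have shift: "(\<Sum>n\<le>m. of_nat (m choose n) * a n) = a 0 + (\<Sum>n\<le>m. of_nat (m choose Suc n) * a (Suc n))"
  proof -
    have "(\<Sum>n\<le>Suc m. of_nat (m choose n) * a n) = a 0 + (\<Sum>n\<le>m. of_nat (m choose Suc n) * a (Suc n))"
      by (subst sum.atMost_Suc_shift) simp
    then show ?thesis by (simp add: binomial_eq_0)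
  qed
  have "(\<Sum>n\<le>Suc m. of_nat (Suc m choose n) * a n)
      = a 0 + (\<Sum>n\<le>m. of_nat (m choose n) * a (Suc n) + of_nat (m choose Suc n) * a (Suc n))"
    by (subst sum.atMost_Suc_shift) (simp add: distrib_right)
  also have "\<dots> = (\<Sum>n\<le>m. of_nat (m choose n) * a n) + (\<Sum>n\<le>m. of_nat (m choose n) * a (Suc n))"
    by (simp only: shift sum.distrib add.assoc add.commute add.left_commute)
  finally show ?thesis
    by (simp add: sum.distrib distrib_left)
qed

lemma nn_integral_PiM_sum_half_sq_relu:
  assumes "finite I" and "F \<in> borel_measurable borel"
  shows "2 ^ card I * (\<integral>\<^sup>+x. F (\<Sum>i\<in>I. half_sq_relu (x i)) \<partial>PiM I (\<lambda>_. std_normal))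
       = (\<Sum>n\<le>card I. of_nat (card I choose n) * gamma_expectation n F)"
  using assms
proof (induction I arbitrary: F rule: finite_induct)
  case empty
  then show ?case by (simp add: PiM_empty gamma_expectation_def)
next
  case (insert i I)
  note F[measurable] = insert.prems
  interpret N: prob_space std_normal by (rule prob_space_std_normal)
  interpret P: product_sigma_finite "\<lambda>_. std_normal"
    by (simp add: product_sigma_finite_def N.sigma_finite_measure_axioms)
  define G where "G c = 2 * (\<integral>\<^sup>+y. F (c + half_sq_relu y) \<partial>std_normal)" for c
  have G[measurable]: "G \<in> borel_measurable borel"
    unfolding G_def by measurable
  have sum_upd: "(\<Sum>j\<in>insert i I. half_sq_relu ((x(i := y)) j)) = (\<Sum>j\<in>I. half_sq_relu (x j)) + half_sq_relu y"
    for x :: "'a \<Rightarrow> real" and y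
  proof -
    have "(\<Sum>j\<in>I. half_sq_relu ((x(i := y)) j)) = (\<Sum>j\<in>I. half_sq_relu (x j))"
      using insert.hyps by (intro sum.cong) auto
    then show ?thesis using insert.hyps by simp
  qed
  have "(\<integral>\<^sup>+x. F (\<Sum>j\<in>insert i I. half_sq_relu (x j)) \<partial>PiM (insert i I) (\<lambda>_. std_normal))
      = (\<integral>\<^sup>+x. (\<integral>\<^sup>+y. F (\<Sum>j\<in>insert i I. half_sq_relu ((x(i := y)) j)) \<partial>std_normal) \<partial>PiM I (\<lambda>_. std_normal))"
    by (rule P.product_nn_integral_insert) (use insert.hyps in auto)
  then have "2 ^ card (insert i I) * (\<integral>\<^sup>+x. F (\<Sum>j\<in>insert i I. half_sq_relu (x j)) \<partial>PiM (insert i I) (\<lambda>_. std_normal))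
      = 2 ^ card I * (\<integral>\<^sup>+x. G (\<Sum>j\<in>I. half_sq_relu (x j)) \<partial>PiM I (\<lambda>_. std_normal))"
    using insert.hyps unfolding G_def sum_upd by (subst nn_integral_cmult) (auto simp: mult_ac)
  also have "\<dots> = (\<Sum>n\<le>card I. of_nat (card I choose n) * (gamma_expectation n F + gamma_expectation (Suc n) F))"
    using insert.IH[OF G] unfolding G_def by (simp add: gamma_expectation_add_half_sq_relu)
  also have "\<dots> = (\<Sum>n\<le>card (insert i I). of_nat (card (insert i I) choose n) * gamma_expectation n F)"
    unfolding card_insert_disjoint[OF insert.hyps] by (rule sum_choose_Pascal)
  finally show ?case .
qed

section \<open>The moment constant\<close>

lemma Gamma_half_ratio_nonneg: "p > 0 \<Longrightarrow> Gamma (real n / 2 + p / 2) / Gamma (real n / 2) \<ge> 0"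
  by (cases "n = 0") (auto intro!: divide_nonneg_pos Gamma_real_pos less_imp_le)

lemma I0_nonneg: "p > 0 \<Longrightarrow> I0 p d \<ge> 0"
  unfolding I0_def by (intro mult_nonneg_nonneg sum_nonneg) (auto intro: Gamma_half_ratio_nonneg)

lemma I0_pos:
  assumes p: "p > 0" and d: "d \<ge> 1"
  shows "I0 p d > 0"
proof -
  have "0 < real (d choose d) * (1 / 2 ^ d) * (Gamma (real d / 2 + p / 2) / Gamma (real d / 2))"
    using d p by (auto intro!: mult_pos_pos divide_pos_pos Gamma_real_pos)
  also have "\<dots> \<le> (\<Sum>n=1..d. real (d choose n) * (1 / 2 ^ d) * (Gamma (real n / 2 + p / 2) / Gamma (real n / 2)))"
    using d by (intro member_le_sum mult_nonneg_nonneg Gamma_half_ratio_nonneg[OF p]) auto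
  finally have "0 < (\<Sum>n=1..d. real (d choose n) * (1 / 2 ^ d) * (Gamma (real n / 2 + p / 2) / Gamma (real n / 2)))" .
  then show ?thesis
    unfolding I0_def by (rule mult_pos_pos[rotated]) simp
qed

lemma powr_mult_I0_eq_sum:
  assumes \<tau>: "\<tau> > 0"
  shows "\<tau> powr p * I0 p d = (\<Sum>n=1..d. real (d choose n) / 2 ^ d *
           ((2 * \<tau>\<^sup>2) powr (p/2) * (Gamma (real n / 2 + p / 2) / Gamma (real n / 2))))"
proof -
  have "\<tau> powr 2 = \<tau>\<^sup>2"
    using \<tau> by (simp add: powr_realpow)
  then have "\<tau>\<^sup>2 powr (p/2) = \<tau> powr p"
    by (metis powr_powr times_divide_eq_right nonzero_mult_div_cancel_left zero_neq_numeral)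
  then have "(2 * \<tau>\<^sup>2) powr (p/2) = 2 powr (p/2) * \<tau> powr p"
    by (simp add: powr_mult)
  then show ?thesis
    unfolding I0_def by (simp add: sum_distrib_left mult_ac)
qed

lemma sigma_bar0_ratio_powr:
  assumes \<sigma>: "\<sigma> > 0" and s: "s > 0" and d: "d \<ge> 1"
  shows "\<sigma> powr s * I0 s d = (\<sigma> / sigma_bar0 s d) powr s"
proof -
  have I0: "I0 s d > 0" by (rule I0_pos[OF s d])
  have "sigma_bar0 s d powr s = I0 s d powr (-1 / s * s)"
    unfolding sigma_bar0_def by (simp add: powr_powr)
  also have "\<dots> = 1 / I0 s d"
    using s I0 by (simp add: powr_minus_divide)
  finally have "sigma_bar0 s d powr s = 1 / I0 s d" .
  then show ?thesis
    by (simp add: powr_divide)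
qed

lemma sigma_bar0_trichotomy:
  assumes \<sigma>: "\<sigma> > 0" and s: "s > 0" and d: "d \<ge> 1"
  shows "\<sigma> < sigma_bar0 s d \<Longrightarrow> 0 < \<sigma> powr s * I0 s d \<and> \<sigma> powr s * I0 s d < 1"
    and "\<sigma> = sigma_bar0 s d \<Longrightarrow> \<sigma> powr s * I0 s d = 1"
    and "\<sigma> > sigma_bar0 s d \<Longrightarrow> \<sigma> powr s * I0 s d > 1"
proof -
  have pos: "sigma_bar0 s d > 0"
    using I0_pos[OF s d] by (simp add: sigma_bar0_def)
  note ratio = sigma_bar0_ratio_powr[OF \<sigma> s d]
  show "\<sigma> < sigma_bar0 s d \<Longrightarrow> 0 < \<sigma> powr s * I0 s d \<and> \<sigma> powr s * I0 s d < 1"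
    using \<sigma> s pos powr_less_mono2[of s "\<sigma> / sigma_bar0 s d" 1] by (simp add: ratio)
  show "\<sigma> = sigma_bar0 s d \<Longrightarrow> \<sigma> powr s * I0 s d = 1"
    unfolding ratio using pos by simp
  show "\<sigma> > sigma_bar0 s d \<Longrightarrow> \<sigma> powr s * I0 s d > 1"
    using s pos powr_less_mono2[of s 1 "\<sigma> / sigma_bar0 s d"] by (simp add: ratio)
qed

lemma sum_choose_atLeast1: "(\<Sum>n=1..d. real (d choose n)) = 2 ^ d - 1"
proof -
  have "{..d} = insert 0 {1..d}" by auto
  then have "(\<Sum>n\<le>d. real (d choose n)) = 1 + (\<Sum>n=1..d. real (d choose n))" by simp
  moreover have "(\<Sum>n\<le>d. real (d choose n)) = 2 ^ d"
    using choose_row_sum[of d] by (metis of_nat_numeral of_nat_power of_nat_sum)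
  ultimately show ?thesis by simp
qed

text \<open>1 - 1/2^d is the mass of the mixture away from its atom at 0.\<close>
lemma I0_Young_interpolation:
  assumes s: "0 < s" "s < p" and \<sigma>: "\<sigma> > 0"
  shows "\<sigma> powr s * I0 s d \<le> (s/p) * (\<sigma> powr p * I0 p d) + (1 - s/p) * (1 - 1 / 2 ^ d)"
proof -
  define c where "c = 2 * \<sigma>\<^sup>2"
  have c: "c > 0" using \<sigma> by (simp add: c_def)
  define m where "m q n = c powr (q/2) * (Gamma (real n / 2 + q / 2) / Gamma (real n / 2))" for q n
  define w where "w n = real (d choose n) / 2 ^ d" for n
  have "\<sigma> powr s * I0 s d = (\<Sum>n=1..d. w n * m s n)"
    unfolding powr_mult_I0_eq_sum[OF \<sigma>] w_def m_def c_def ..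
  also have "\<dots> \<le> (\<Sum>n=1..d. w n * ((s/p) * m p n + (1 - s/p)))"
  proof (intro sum_mono mult_left_mono)
    fix n assume "n \<in> {1..d}"
    then have "real n / 2 > 0" by auto
    from gamma_moment_le_Young_interpolation[OF this s c]
    show "m s n \<le> (s/p) * m p n + (1 - s/p)"
      unfolding m_def by (simp add: add_ac)
  qed (simp add: w_def)
  also have "\<dots> = (s/p) * (\<Sum>n=1..d. w n * m p n) + (1 - s/p) * (\<Sum>n=1..d. w n)"
    by (simp add: sum.distrib sum_distrib_left distrib_left mult_ac)
  also have "(\<Sum>n=1..d. w n * m p n) = \<sigma> powr p * I0 p d"
    unfolding powr_mult_I0_eq_sum[OF \<sigma>] w_def m_def c_def ..
  also have "(\<Sum>n=1..d. w n) = 1 - 1 / 2 ^ d"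
    unfolding w_def sum_divide_distrib[symmetric] sum_choose_atLeast1 by (simp add: diff_divide_distrib)
  finally show ?thesis .
qed

lemma I0_gt_one_above_critical:
  assumes s: "0 < s" "s < p" and \<sigma>: "\<sigma> > 0" and crit: "\<sigma> powr s * I0 s d = 1"
  shows "\<sigma> powr p * I0 p d > 1"
proof (rule ccontr)
  assume "\<not> \<sigma> powr p * I0 p d > 1"
  moreover have "0 < s / p" "s / p < 1"
    using s by auto
  ultimately have "(s/p) * (\<sigma> powr p * I0 p d) + (1 - s/p) * (1 - 1 / 2 ^ d) < (s/p) * 1 + (1 - s/p) * 1"
    by (intro add_le_less_mono mult_left_mono mult_strict_left_mono) auto
  then show False
    using I0_Young_interpolation[OF s \<sigma>, of d] crit by simp
qed

text \<open>For n = 0 both sides vanish, as Gamma 0 = 0 and division by zero yields 0.\<close>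
lemma gamma_expectation_scaled_powr:
  assumes c: "c > 0" and p: "p > 0"
  shows "gamma_expectation n (\<lambda>z. ennreal ((c * z) powr (p/2)))
       = ennreal (c powr (p/2) * (Gamma (real n / 2 + p / 2) / Gamma (real n / 2)))"
  using nn_integral_scaled_powr_gamma_density[of "real n / 2" c "p/2"] c p
  by (cases "n = 0") (simp_all add: gamma_expectation_def)

lemma nn_integral_PiM_powr_sum_half_sq_relu:
  assumes I: "finite I" and p: "p > 0" and \<tau>: "\<tau> > 0"
  shows "(\<integral>\<^sup>+x. ennreal ((2 * \<tau>\<^sup>2 * (\<Sum>i\<in>I. half_sq_relu (x i))) powr (p/2)) \<partial>PiM I (\<lambda>_. std_normal))
       = ennreal (\<tau> powr p * I0 p (card I))"
proof -
  define d where "d = card I"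
  define c where "c = 2 * \<tau>\<^sup>2"
  have c: "c > 0" using \<tau> by (simp add: c_def)
  define m where "m n = c powr (p/2) * (Gamma (real n / 2 + p / 2) / Gamma (real n / 2))" for n
  have m_nonneg: "m n \<ge> 0" for n
    unfolding m_def using p by (intro mult_nonneg_nonneg Gamma_half_ratio_nonneg) auto
  have two_pow: "(2::ennreal) ^ d = ennreal (2 ^ d)"
    by (metis ennreal_numeral ennreal_power zero_le_numeral)
  have "2 ^ d * (\<integral>\<^sup>+x. ennreal ((c * (\<Sum>i\<in>I. half_sq_relu (x i))) powr (p/2)) \<partial>PiM I (\<lambda>_. std_normal))
      = (\<Sum>n\<le>d. of_nat (d choose n) * gamma_expectation n (\<lambda>z. ennreal ((c * z) powr (p/2))))"
    unfolding d_def by (rule nn_integral_PiM_sum_half_sq_relu[OF I]) measurable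
  also have "\<dots> = (\<Sum>n\<le>d. ennreal (real (d choose n) * m n))"
    using c p m_nonneg
    by (intro sum.cong refl)
       (simp add: gamma_expectation_scaled_powr m_def ennreal_mult'[symmetric] ennreal_of_nat_eq_real_of_nat)
  also have "\<dots> = ennreal (\<Sum>n\<le>d. real (d choose n) * m n)"
    using m_nonneg by (intro sum_ennreal) auto
  also have "(\<Sum>n\<le>d. real (d choose n) * m n) = 2 ^ d * (\<tau> powr p * I0 p d)"
  proof -
    have "{..d} = insert 0 {1..d}" by auto
    then show ?thesis
      by (simp add: m_def c_def powr_mult_I0_eq_sum[OF \<tau>] sum_distrib_left)
  qed
  finally have "2 ^ d * (\<integral>\<^sup>+x. ennreal ((c * (\<Sum>i\<in>I. half_sq_relu (x i))) powr (p/2)) \<partial>PiM I (\<lambda>_. std_normal))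
      = 2 ^ d * ennreal (\<tau> powr p * I0 p d)"
    using I0_nonneg[OF p] by (simp add: two_pow ennreal_mult')
  moreover have "(2::ennreal) ^ d \<noteq> \<top>"
    unfolding two_pow by simp
  ultimately show ?thesis
    by (simp add: ennreal_mult_cancel_left c_def d_def)
qed

section \<open>Network layers as measurable maps\<close>

lemma borel_measurable_vec:
  fixes f :: "'a \<Rightarrow> 'b::euclidean_space^'n"
  assumes "\<And>j. (\<lambda>x. f x $ j) \<in> borel_measurable M"
  shows "f \<in> borel_measurable M"
proof -
  have "(\<lambda>x. f x \<bullet> b) \<in> borel_measurable M" if "b \<in> Basis" for b
  proof -
    obtain j u where b: "b = axis j u" using \<open>b \<in> Basis\<close> by (auto simp: Basis_vec_def)
    have "(\<lambda>x. f x \<bullet> b) = (\<lambda>x. f x $ j \<bullet> u)" unfolding b by (simp add: inner_axis)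
    then show ?thesis using assms by simp
  qed
  then show ?thesis by (subst borel_measurable_euclidean_space) blast
qed

lemma borel_measurable_vec_nth[measurable]: "(\<lambda>x::'b::euclidean_space^'n. x $ j) \<in> borel_measurable borel"
  by (intro borel_measurable_continuous_onI continuous_intros)

lemma borel_measurable_prelu[measurable]: "prelu a \<in> borel_measurable borel"
  unfolding prelu_def by measurable

definition relu_vec :: "real^'n \<Rightarrow> real^'n" where
  "relu_vec u = (\<chi> i. prelu 0 (u $ i))"

lemma borel_measurable_relu_vec[measurable]: "relu_vec \<in> borel_measurable borel"
  by (rule borel_measurable_vec) (simp add: relu_vec_def)

lemma layer_out_Suc_relu_vec: "layer_out 0 W x0 (Suc k) \<omega> = relu_vec (W k \<omega> *v layer_out 0 W x0 k \<omega>)"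
  by (simp add: relu_vec_def)

lemma norm_vec_powr: "norm (x::real^'n) powr p = (\<Sum>i\<in>UNIV. (x $ i)\<^sup>2) powr (p/2)"
proof -
  have "norm x = (\<Sum>i\<in>UNIV. (x $ i)\<^sup>2) powr (1/2)"
    unfolding norm_vec_def L2_set_def by (simp add: powr_half_sqrt sum_nonneg)
  then show ?thesis by (simp add: powr_powr)
qed

lemma prelu_mult_sq: "t > 0 \<Longrightarrow> (prelu 0 (t * y))\<^sup>2 = t\<^sup>2 * (2 * half_sq_relu y)"
  by (auto simp: prelu_def half_sq_relu_def max_def power_mult_distrib zero_less_mult_iff mult_le_0_iff)

lemma (in prob_space) nn_integral_indep_var:
  assumes indep: "indep_var S A T B" and H[measurable]: "H \<in> borel_measurable (S \<Otimes>\<^sub>M T)"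
  shows "(\<integral>\<^sup>+\<omega>. H (A \<omega>, B \<omega>) \<partial>M) = (\<integral>\<^sup>+\<omega>. (\<integral>\<^sup>+\<omega>'. H (A \<omega>', B \<omega>) \<partial>M) \<partial>M)"
proof -
  have A[measurable]: "A \<in> measurable M S" and B[measurable]: "B \<in> measurable M T"
    and prod: "distr M S A \<Otimes>\<^sub>M distr M T B = distr M (S \<Otimes>\<^sub>M T) (\<lambda>\<omega>. (A \<omega>, B \<omega>))"
    using indep unfolding indep_var_distribution_eq by auto
  interpret SA: prob_space "distr M S A" by (rule prob_space_distr) simp
  interpret TB: prob_space "distr M T B" by (rule prob_space_distr) simp
  interpret ST: pair_sigma_finite "distr M S A" "distr M T B" ..
  have "(\<integral>\<^sup>+\<omega>. H (A \<omega>, B \<omega>) \<partial>M) = (\<integral>\<^sup>+z. H z \<partial>(distr M S A \<Otimes>\<^sub>M distr M T B))"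
    unfolding prod by (rule nn_integral_distr[symmetric]) measurable
  also have "\<dots> = (\<integral>\<^sup>+b. (\<integral>\<^sup>+a. H (a, b) \<partial>distr M S A) \<partial>distr M T B)"
    by (rule ST.nn_integral_snd[symmetric]) (simp add: H cong: measurable_cong_sets)
  also have "\<dots> = (\<integral>\<^sup>+b. (\<integral>\<^sup>+\<omega>'. H (A \<omega>', b) \<partial>M) \<partial>distr M T B)"
  proof (rule nn_integral_cong)
    fix b assume "b \<in> space (distr M T B)"
    then have "(\<lambda>a. H (a, b)) \<in> borel_measurable S"
      by (intro measurable_Pair1[OF H]) simp
    then show "(\<integral>\<^sup>+a. H (a, b) \<partial>distr M S A) = (\<integral>\<^sup>+\<omega>'. H (A \<omega>', b) \<partial>M)"
      by (subst nn_integral_distr) auto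
  qed
  also have "\<dots> = (\<integral>\<^sup>+\<omega>. (\<integral>\<^sup>+\<omega>'. H (A \<omega>', B \<omega>) \<partial>M) \<partial>M)"
    by (rule nn_integral_distr) measurable
  finally show ?thesis .
qed

lemma layer_out_cong:
  assumes "\<And>k'. k' < k \<Longrightarrow> W' k' \<omega>' = W k' \<omega>"
  shows "layer_out a W' x0 k \<omega>' = layer_out a W x0 k \<omega>"
  using assms by (induction k) auto

text \<open>To separate the weights of layer k from those of the earlier layers, the network is
  re-read as a function of the family of all weight entries, indexed by (layer, row, column).\<close>
definition matrix_of_entries :: "nat \<Rightarrow> (nat \<times> 'n \<times> 'n \<Rightarrow> real) \<Rightarrow> real^'n^'n" where
  "matrix_of_entries k b = (\<chi> i j. b (k, i, j))"

definition entries_before :: "nat \<Rightarrow> (nat \<times> 'n \<times> 'n) set" where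
  "entries_before k = {t. fst t < k}"

definition entries_at :: "nat \<Rightarrow> (nat \<times> 'n \<times> 'n) set" where
  "entries_at k = {t. fst t = k}"

lemma matrix_of_entries_nth[simp]: "matrix_of_entries k b $ i $ j = b (k, i, j)"
  by (simp add: matrix_of_entries_def)

lemma borel_measurable_matrix_of_entries:
  "matrix_of_entries k \<in> borel_measurable (PiM (entries_at k) (\<lambda>_. borel :: real measure))"
  by (intro borel_measurable_vec)
     (simp, rule measurable_component_singleton, simp add: entries_at_def)

lemma borel_measurable_layer_out_entries_before:
  "(\<lambda>b. layer_out 0 matrix_of_entries x0 k b) \<in> borel_measurable (PiM (entries_before k) (\<lambda>_. borel :: real measure))"
proof -
  have "(\<lambda>b. layer_out 0 matrix_of_entries x0 k' b $ j) \<in> borel_measurable (PiM (entries_before k) (\<lambda>_. borel))"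
    if "k' \<le> k" for k' j
    using that
  proof (induction k' arbitrary: j)
    case (Suc k')
    have "(\<lambda>b. layer_out 0 matrix_of_entries x0 k' b $ l) \<in> borel_measurable (PiM (entries_before k) (\<lambda>_. borel))"
      for l using Suc by simp
    moreover have "(\<lambda>b. b (k', j, l)) \<in> borel_measurable (PiM (entries_before k) (\<lambda>_. borel :: real measure))"
      for l using Suc.prems by (intro measurable_component_singleton) (simp add: entries_before_def)
    ultimately have "(\<lambda>b. prelu 0 (\<Sum>l\<in>UNIV. b (k', j, l) * layer_out 0 matrix_of_entries x0 k' b $ l))
        \<in> borel_measurable (PiM (entries_before k) (\<lambda>_. borel))"
      by measurable
    then show ?case by (simp add: matrix_vector_mult_def)
  qed simp
  then show ?thesis by (intro borel_measurable_vec) simp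
qed

section \<open>The Gaussian network\<close>

locale gaussian_network =
  fixes M :: "'w measure" and W :: "nat \<Rightarrow> 'w \<Rightarrow> real^'n^'n" and \<sigma> :: real
  assumes prob_space: "prob_space M" and \<sigma>_pos: "\<sigma> > 0"
    and indep_weights: "prob_space.indep_vars M (\<lambda>_. borel) (\<lambda>(k, i, j) \<omega>. W k \<omega> $ i $ j) UNIV"
    and distributed_weights: "\<And>k i j. distributed M lborel (\<lambda>\<omega>. W k \<omega> $ i $ j) (normal_density 0 \<sigma>)"
begin

sublocale prob_space M by (rule prob_space)

definition entry :: "nat \<times> 'n \<times> 'n \<Rightarrow> 'w \<Rightarrow> real" where
  "entry = (\<lambda>(k, i, j) \<omega>. W k \<omega> $ i $ j)"

lemma entry_simp[simp]: "entry (k, i, j) \<omega> = W k \<omega> $ i $ j"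
  by (simp add: entry_def)

lemma borel_measurable_weight[measurable]: "(\<lambda>\<omega>. W k \<omega> $ i $ j) \<in> borel_measurable M"
  using distributed_measurable[OF distributed_weights[of k i j]] by simp

lemma indep_vars_entry: "indep_vars (\<lambda>_. borel) entry UNIV"
  using indep_weights unfolding entry_def .

lemma indep_vars_entry_blocks:
  assumes "disjoint_family_on K L"
  shows "indep_vars (\<lambda>l. PiM (K l) (\<lambda>_. borel)) (\<lambda>l \<omega>. restrict (\<lambda>t. entry t \<omega>) (K l)) L"
  by (rule indep_vars_restrict[OF indep_vars_entry _ assms]) simp

lemma indep_vars_row_entries:
  "indep_vars (\<lambda>_. borel) (\<lambda>j \<omega>. W k \<omega> $ i $ j * c j) UNIV"
proof -
  have "indep_vars (\<lambda>j. PiM {(k, i, j)} (\<lambda>_. borel)) (\<lambda>j \<omega>. restrict (\<lambda>t. entry t \<omega>) {(k, i, j)}) UNIV"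
    by (rule indep_vars_entry_blocks) (auto simp: disjoint_family_on_def)
  then have "indep_vars (\<lambda>_. borel) (\<lambda>j \<omega>. (\<lambda>r. r (k, i, j) * c j) (restrict (\<lambda>t. entry t \<omega>) {(k, i, j)})) UNIV"
    by (rule indep_vars_compose2) measurable
  then show ?thesis by simp
qed

lemma indep_vars_rows:
  "indep_vars (\<lambda>_. borel) (\<lambda>i \<omega>. \<Sum>j\<in>UNIV. W k \<omega> $ i $ j * c j) UNIV"
proof -
  have "indep_vars (\<lambda>i. PiM ({k} \<times> {i} \<times> UNIV) (\<lambda>_. borel))
          (\<lambda>i \<omega>. restrict (\<lambda>t. entry t \<omega>) ({k} \<times> {i} \<times> UNIV)) UNIV"
    by (rule indep_vars_entry_blocks) (auto simp: disjoint_family_on_def)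
  then have "indep_vars (\<lambda>_. borel)
      (\<lambda>i \<omega>. (\<lambda>r. \<Sum>j\<in>UNIV. r (k, i, j) * c j) (restrict (\<lambda>t. entry t \<omega>) ({k} \<times> {i} \<times> UNIV))) UNIV"
    by (rule indep_vars_compose2) measurable
  then show ?thesis by simp
qed

lemma indep_var_layer_entries:
  "indep_var (PiM (entries_at k) (\<lambda>_. borel)) (\<lambda>\<omega>. restrict (\<lambda>t. entry t \<omega>) (entries_at k))
             (PiM (entries_before k) (\<lambda>_. borel)) (\<lambda>\<omega>. restrict (\<lambda>t. entry t \<omega>) (entries_before k))"
proof -
  have blocks: "indep_vars (\<lambda>b. PiM (case_bool (entries_at k) (entries_before k) b) (\<lambda>_. borel))
      (\<lambda>b \<omega>. restrict (\<lambda>t. entry t \<omega>) (case_bool (entries_at k) (entries_before k) b)) UNIV"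
    by (rule indep_vars_entry_blocks)
       (auto simp: disjoint_family_on_def entries_at_def entries_before_def split: bool.split)
  have spaces: "(\<lambda>b. PiM (case_bool (entries_at k) (entries_before k) b) (\<lambda>_. borel))
      = case_bool (PiM (entries_at k) (\<lambda>_. borel)) (PiM (entries_before k) (\<lambda>_. borel :: real measure))"
    by (rule ext) (simp split: bool.split)
  have variables: "(\<lambda>b \<omega>. restrict (\<lambda>t. entry t \<omega>) (case_bool (entries_at k) (entries_before k) b))
      = case_bool (\<lambda>\<omega>. restrict (\<lambda>t. entry t \<omega>) (entries_at k)) (\<lambda>\<omega>. restrict (\<lambda>t. entry t \<omega>) (entries_before k))"
    by (rule ext) (simp split: bool.split)
  show ?thesis
    unfolding indep_var_def using blocks by (simp only: spaces variables)
qed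

lemma distributed_row:
  assumes v: "v \<noteq> 0"
  shows "distributed M lborel (\<lambda>\<omega>. \<Sum>j\<in>UNIV. W k \<omega> $ i $ j * v $ j) (normal_density 0 (\<sigma> * norm v))"
proof -
  define S where "S = {j. v $ j \<noteq> 0}"
  have S: "S \<noteq> {}" using v unfolding S_def by (auto simp: vec_eq_iff)
  have "distributed M lborel (\<lambda>\<omega>. W k \<omega> $ i $ j * v $ j) (normal_density 0 (\<bar>v $ j\<bar> * \<sigma>))"
    if "j \<in> S" for j
  proof -
    have "v $ j \<noteq> 0" using that by (simp add: S_def)
    from normal_density_affine[OF distributed_weights[of k i j] \<sigma>_pos this, of 0]
    show ?thesis by (simp add: mult.commute)
  qed
  moreover have "indep_vars (\<lambda>_. borel) (\<lambda>j \<omega>. W k \<omega> $ i $ j * v $ j) S"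
    by (rule indep_vars_subset[OF indep_vars_row_entries]) simp
  ultimately have "distributed M lborel (\<lambda>\<omega>. \<Sum>j\<in>S. W k \<omega> $ i $ j * v $ j)
               (normal_density (\<Sum>j\<in>S. 0) (sqrt (\<Sum>j\<in>S. (\<bar>v $ j\<bar> * \<sigma>)\<^sup>2)))"
    by (intro sum_indep_normal[OF _ S]) (auto simp: S_def \<sigma>_pos)
  moreover have "(\<lambda>\<omega>. \<Sum>j\<in>S. W k \<omega> $ i $ j * v $ j) = (\<lambda>\<omega>. \<Sum>j\<in>UNIV. W k \<omega> $ i $ j * v $ j)"
    by (intro ext sum.mono_neutral_left) (auto simp: S_def)
  moreover have "(\<Sum>j\<in>S. (\<bar>v $ j\<bar> * \<sigma>)\<^sup>2) = \<sigma>\<^sup>2 * (\<Sum>j\<in>UNIV. (v $ j)\<^sup>2)"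
    by (subst sum.mono_neutral_left[of UNIV])
       (auto simp: S_def sum_distrib_left power_mult_distrib mult.commute)
  ultimately show ?thesis
    using \<sigma>_pos by (simp add: norm_vec_def L2_set_def real_sqrt_mult)
qed

definition normalized_row :: "real^'n \<Rightarrow> nat \<Rightarrow> 'n \<Rightarrow> 'w \<Rightarrow> real" where
  "normalized_row v k i \<omega> = inverse (\<sigma> * norm v) * (\<Sum>j\<in>UNIV. W k \<omega> $ i $ j * v $ j)"

lemma borel_measurable_normalized_row[measurable]: "normalized_row v k i \<in> borel_measurable M"
  unfolding normalized_row_def by measurable

lemma distributed_normalized_row:
  assumes v: "v \<noteq> 0"
  shows "distributed M lborel (normalized_row v k i) std_normal_density"
proof -
  have c: "inverse (\<sigma> * norm v) \<noteq> 0" "\<sigma> * norm v > 0"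
    using v \<sigma>_pos by auto
  have "inverse \<bar>\<sigma>\<bar> * inverse (norm v) * (\<sigma> * norm v) = 1"
    using \<sigma>_pos v by (simp add: field_simps)
  with normal_density_affine[OF distributed_row[OF v] c(2) c(1), of 0] show ?thesis
    using c unfolding normalized_row_def by (simp add: abs_mult)
qed

lemma distr_normalized_rows:
  assumes v: "v \<noteq> 0"
  shows "distr M (PiM UNIV (\<lambda>_. borel)) (\<lambda>\<omega>. \<lambda>i\<in>UNIV. normalized_row v k i \<omega>) = PiM UNIV (\<lambda>_. std_normal)"
proof -
  have "indep_vars (\<lambda>_. borel) (\<lambda>i \<omega>. (\<lambda>x. inverse (\<sigma> * norm v) * x) (\<Sum>j\<in>UNIV. W k \<omega> $ i $ j * v $ j)) UNIV"
    by (rule indep_vars_compose2[OF indep_vars_rows]) measurable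
  then have "indep_vars (\<lambda>_. borel) (normalized_row v k) UNIV"
    unfolding normalized_row_def by simp
  then have "distr M (PiM UNIV (\<lambda>_. borel)) (\<lambda>\<omega>. \<lambda>i\<in>UNIV. normalized_row v k i \<omega>)
      = PiM UNIV (\<lambda>i. distr M borel (normalized_row v k i))"
    by (simp add: indep_vars_iff_distr_eq_PiM)
  moreover have "distr M borel (normalized_row v k i) = std_normal" for i
  proof -
    have "distr M borel (normalized_row v k i) = distr M lborel (normalized_row v k i)"
      by (rule distr_cong) auto
    also have "\<dots> = std_normal"
      unfolding std_normal_def by (rule distributed_distr_eq_density[OF distributed_normalized_row[OF v]])
    finally show ?thesis .
  qed
  ultimately show ?thesis by simp
qed

lemma nn_integral_norm_relu_vec_powr:
  assumes p: "p > 0"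
  shows "(\<integral>\<^sup>+\<omega>. ennreal (norm (relu_vec (W k \<omega> *v v)) powr p) \<partial>M)
       = ennreal (\<sigma> powr p * norm v powr p * I0 p CARD('n))"
proof (cases "v = 0")
  case True
  then have "relu_vec (W k \<omega> *v v) = 0" for \<omega>
    by (simp add: relu_vec_def prelu_def vec_eq_iff matrix_vector_mult_def)
  then show ?thesis using True by simp
next
  case False
  define \<tau> where "\<tau> = \<sigma> * norm v"
  have \<tau>: "\<tau> > 0" using \<sigma>_pos False by (simp add: \<tau>_def)
  define S where "S x = ennreal ((2 * \<tau>\<^sup>2 * (\<Sum>i\<in>UNIV. half_sq_relu (x i))) powr (p/2))" for x :: "'n \<Rightarrow> real"
  have "norm (relu_vec (W k \<omega> *v v)) powr p = (2 * \<tau>\<^sup>2 * (\<Sum>i\<in>UNIV. half_sq_relu (normalized_row v k i \<omega>))) powr (p/2)" for \<omega>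
  proof -
    have "(W k \<omega> *v v) $ i = \<tau> * normalized_row v k i \<omega>" for i
      using \<sigma>_pos False by (simp add: normalized_row_def \<tau>_def matrix_vector_mult_def field_simps)
    then have "(\<Sum>i\<in>UNIV. (relu_vec (W k \<omega> *v v) $ i)\<^sup>2) = 2 * \<tau>\<^sup>2 * (\<Sum>i\<in>UNIV. half_sq_relu (normalized_row v k i \<omega>))"
      using \<tau> by (simp add: relu_vec_def prelu_mult_sq sum_distrib_left mult_ac)
    then show ?thesis by (simp add: norm_vec_powr)
  qed
  then have "(\<integral>\<^sup>+\<omega>. ennreal (norm (relu_vec (W k \<omega> *v v)) powr p) \<partial>M)
      = (\<integral>\<^sup>+\<omega>. S (\<lambda>i\<in>UNIV. normalized_row v k i \<omega>) \<partial>M)"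
    by (simp add: S_def)
  also have "\<dots> = (\<integral>\<^sup>+x. S x \<partial>distr M (PiM UNIV (\<lambda>_. borel)) (\<lambda>\<omega>. \<lambda>i\<in>UNIV. normalized_row v k i \<omega>))"
    by (rule nn_integral_distr[symmetric]) (measurable, simp add: S_def)
  also have "\<dots> = ennreal (\<tau> powr p * I0 p CARD('n))"
    unfolding distr_normalized_rows[OF False] S_def
    using nn_integral_PiM_powr_sum_half_sq_relu[of "UNIV :: 'n set" p \<tau>] p \<tau> by simp
  finally show ?thesis
    using \<sigma>_pos by (simp add: \<tau>_def powr_mult)
qed

lemma nn_integral_layer_out_Suc:
  assumes G[measurable]: "G \<in> borel_measurable borel"
    and \<Phi>: "\<And>v. (\<integral>\<^sup>+\<omega>. G (relu_vec (W k \<omega> *v v)) \<partial>M) = \<Phi> v"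
  shows "(\<integral>\<^sup>+\<omega>. G (layer_out 0 W x0 (Suc k) \<omega>) \<partial>M) = (\<integral>\<^sup>+\<omega>. \<Phi> (layer_out 0 W x0 k \<omega>) \<partial>M)"
proof -
  define S where "S = PiM (entries_at k :: (nat \<times> 'n \<times> 'n) set) (\<lambda>_. borel :: real measure)"
  define T where "T = PiM (entries_before k :: (nat \<times> 'n \<times> 'n) set) (\<lambda>_. borel :: real measure)"
  define A where "A \<omega> = restrict (\<lambda>t. entry t \<omega>) (entries_at k)" for \<omega>
  define B where "B \<omega> = restrict (\<lambda>t. entry t \<omega>) (entries_before k)" for \<omega>
  define H where "H z = G (relu_vec (matrix_of_entries k (fst z) *v layer_out 0 matrix_of_entries x0 k (snd z)))"
    for z
  have [measurable]: "matrix_of_entries k \<in> borel_measurable S"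
    "(\<lambda>b. layer_out 0 matrix_of_entries x0 k b) \<in> borel_measurable T"
    unfolding S_def T_def
    by (rule borel_measurable_matrix_of_entries borel_measurable_layer_out_entries_before)+
  have "(\<lambda>z. matrix_of_entries k (fst z) *v layer_out 0 matrix_of_entries x0 k (snd z)) \<in> borel_measurable (S \<Otimes>\<^sub>M T)"
  proof (rule borel_measurable_vec)
    fix i :: 'n
    have "(\<lambda>z. \<Sum>j\<in>UNIV. matrix_of_entries k (fst z) $ i $ j * layer_out 0 matrix_of_entries x0 k (snd z) $ j)
        \<in> borel_measurable (S \<Otimes>\<^sub>M T)"
      by measurable
    then show "(\<lambda>z. (matrix_of_entries k (fst z) *v layer_out 0 matrix_of_entries x0 k (snd z)) $ i)
        \<in> borel_measurable (S \<Otimes>\<^sub>M T)"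
      by (simp only: matrix_vector_mult_def vec_lambda_beta)
  qed
  then have H: "H \<in> borel_measurable (S \<Otimes>\<^sub>M T)"
    unfolding H_def by measurable
  have A: "matrix_of_entries k (A \<omega>) = W k \<omega>" for \<omega>
    by (simp add: vec_eq_iff A_def entries_at_def)
  have B: "layer_out 0 matrix_of_entries x0 k (B \<omega>) = layer_out 0 W x0 k \<omega>" for \<omega>
    by (rule layer_out_cong) (simp add: vec_eq_iff B_def entries_before_def)
  have "(\<integral>\<^sup>+\<omega>. G (layer_out 0 W x0 (Suc k) \<omega>) \<partial>M) = (\<integral>\<^sup>+\<omega>. H (A \<omega>, B \<omega>) \<partial>M)"
    by (simp only: H_def A B layer_out_Suc_relu_vec fst_conv snd_conv)
  also have "\<dots> = (\<integral>\<^sup>+\<omega>. (\<integral>\<^sup>+\<omega>'. H (A \<omega>', B \<omega>) \<partial>M) \<partial>M)"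
    using indep_var_layer_entries[of k] H unfolding S_def T_def A_def B_def
    by (rule nn_integral_indep_var)
  also have "\<dots> = (\<integral>\<^sup>+\<omega>. \<Phi> (layer_out 0 W x0 k \<omega>) \<partial>M)"
    by (simp add: H_def A B \<Phi>)
  finally show ?thesis .
qed

lemma borel_measurable_layer_out: "(\<lambda>\<omega>. layer_out 0 W x0 k \<omega>) \<in> borel_measurable M"
proof (rule borel_measurable_vec)
  show "(\<lambda>\<omega>. layer_out 0 W x0 k \<omega> $ j) \<in> borel_measurable M" for j
  proof (induction k arbitrary: j)
    case (Suc k)
    have "(\<lambda>\<omega>. prelu 0 (\<Sum>l\<in>UNIV. W k \<omega> $ j $ l * layer_out 0 W x0 k \<omega> $ l)) \<in> borel_measurable M"
      using Suc by measurable
    then show ?case by (simp add: matrix_vector_mult_def)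
  qed simp
qed

lemma nn_integral_norm_layer_out_powr:
  assumes p: "p > 0"
  shows "(\<integral>\<^sup>+\<omega>. ennreal (norm (layer_out 0 W x0 k \<omega>) powr p) \<partial>M)
       = ennreal (norm x0 powr p * (\<sigma> powr p * I0 p CARD('n)) ^ k)"
proof (induction k)
  case 0
  then show ?case by (simp add: emeasure_space_1)
next
  case (Suc k)
  define c where "c = \<sigma> powr p * I0 p CARD('n)"
  have c: "c \<ge> 0" unfolding c_def using I0_nonneg[OF p] by simp
  have "(\<integral>\<^sup>+\<omega>. ennreal (norm (layer_out 0 W x0 (Suc k) \<omega>) powr p) \<partial>M)
      = (\<integral>\<^sup>+\<omega>. ennreal c * ennreal (norm (layer_out 0 W x0 k \<omega>) powr p) \<partial>M)"
    using c
    by (intro nn_integral_layer_out_Suc)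
       (auto simp: nn_integral_norm_relu_vec_powr[OF p] c_def ennreal_mult[symmetric] mult_ac)
  also have "\<dots> = ennreal (norm x0 powr p * c ^ Suc k)"
    using borel_measurable_layer_out[of x0 k] c
    by (subst nn_integral_cmult) (auto simp: Suc c_def ennreal_mult[symmetric] mult_ac)
  finally show ?case by (simp add: c_def)
qed

lemma expectation_norm_layer_out_powr:
  assumes p: "p > 0"
  shows "expectation (\<lambda>\<omega>. norm (layer_out 0 W x0 k \<omega>) powr p)
       = norm x0 powr p * (\<sigma> powr p * I0 p CARD('n)) ^ k"
  using borel_measurable_layer_out[of x0 k] I0_nonneg[OF p]
  by (subst integral_eq_nn_integral) (auto simp: nn_integral_norm_layer_out_powr[OF p])

end

theorem mainTheorem1:
  fixes M :: "'w measure" and W :: "nat \<Rightarrow> 'w \<Rightarrow> real^'n^'n"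
    and x0 :: "real^'n" and \<sigma> s :: real
  assumes "prob_space M"
    and "\<sigma> > 0" and "s > 0"
    and "prob_space.indep_vars M (\<lambda>_. borel) (\<lambda>(k, i, j) \<omega>. W k \<omega> $ i $ j) UNIV"
    and "\<And>k i j. distributed M lborel (\<lambda>\<omega>. W k \<omega> $ i $ j) (normal_density 0 \<sigma>)"
  shows "(\<forall>k. prob_space.expectation M (\<lambda>\<omega>. norm (layer_out 0 W x0 k \<omega>) powr s)
              = norm x0 powr s * (\<sigma> powr s * I0 s CARD('n)) ^ k)
     \<and> (x0 \<noteq> 0 \<longrightarrow>
         (\<sigma> = sigma_bar0 s CARD('n) \<longrightarrow>
            (\<forall>k\<ge>1. prob_space.expectation M (\<lambda>\<omega>. norm (layer_out 0 W x0 k \<omega>) powr s)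
                      = norm x0 powr s)
          \<and> (\<forall>p>s. \<exists>r>1. \<exists>C>0. \<forall>\<^sub>F k in sequentially.
                 prob_space.expectation M (\<lambda>\<omega>. norm (layer_out 0 W x0 k \<omega>) powr p) \<ge> C * r ^ k))
       \<and> (\<sigma> < sigma_bar0 s CARD('n) \<longrightarrow>
            (\<exists>r. 0 < r \<and> r < 1 \<and> (\<exists>C>0. \<forall>\<^sub>F k in sequentially.
                 prob_space.expectation M (\<lambda>\<omega>. norm (layer_out 0 W x0 k \<omega>) powr s) \<le> C * r ^ k)))
       \<and> (\<sigma> > sigma_bar0 s CARD('n) \<longrightarrow>
            (\<exists>r>1. \<exists>C>0. \<forall>\<^sub>F k in sequentially.
                 prob_space.expectation M (\<lambda>\<omega>. norm (layer_out 0 W x0 k \<omega>) powr s) \<ge> C * r ^ k)))"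
proof -
  interpret gaussian_network M W \<sigma>
    using assms(1,2,4,5) by (rule gaussian_network.intro)
  define d where "d = CARD('n)"
  define \<rho> where "\<rho> p = \<sigma> powr p * I0 p d" for p
  have moment: "expectation (\<lambda>\<omega>. norm (layer_out 0 W x0 k \<omega>) powr p) = norm x0 powr p * \<rho> p ^ k"
    if "p > 0" for p k
    using expectation_norm_layer_out_powr[OF that] by (simp add: \<rho>_def d_def)
  have d: "d \<ge> 1" by (simp add: d_def Suc_le_eq)
  note below = sigma_bar0_trichotomy(1)[OF \<sigma>_pos \<open>s > 0\<close> d, folded \<rho>_def]
    and critical = sigma_bar0_trichotomy(2)[OF \<sigma>_pos \<open>s > 0\<close> d, folded \<rho>_def]
    and above = sigma_bar0_trichotomy(3)[OF \<sigma>_pos \<open>s > 0\<close> d, folded \<rho>_def]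
  have higher: "\<sigma> = sigma_bar0 s d \<Longrightarrow> p > s \<Longrightarrow> \<rho> p > 1" for p
    using critical I0_gt_one_above_critical[OF \<open>s > 0\<close> _ \<sigma>_pos] by (simp add: \<rho>_def)
  have growth: "\<exists>r>1. \<exists>C>0. \<forall>\<^sub>F k in sequentially. expectation (\<lambda>\<omega>. norm (layer_out 0 W x0 k \<omega>) powr p) \<ge> C * r ^ k"
    if "x0 \<noteq> 0" "p > 0" "\<rho> p > 1" for p
    using that moment by (intro exI[of _ "\<rho> p"] conjI exI[of _ "norm x0 powr p"]) auto
  have decay: "\<exists>r. 0 < r \<and> r < 1 \<and> (\<exists>C>0. \<forall>\<^sub>F k in sequentially.
                 expectation (\<lambda>\<omega>. norm (layer_out 0 W x0 k \<omega>) powr s) \<le> C * r ^ k)"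
    if "x0 \<noteq> 0" "0 < \<rho> s" "\<rho> s < 1"
    using that moment \<open>s > 0\<close> by (intro exI[of _ "\<rho> s"] conjI exI[of _ "norm x0 powr s"]) auto
  show ?thesis
    using moment[OF \<open>s > 0\<close>] growth[OF _ \<open>s > 0\<close>] growth[OF _ less_trans[OF \<open>s > 0\<close>]] decay
      below above critical higher
    unfolding d_def \<rho>_def by auto
qed

end
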